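(* There exist absolute constants $c_1,c_2>0$ and $n_0\in\mathbf{N}$ such that for every integer $n\ge n_0$ and every transitive subgroup $G$ of $S_n$, there is a subset $X\subset G$ whose density $\alpha=|X|/|G|$ satisfies $$c_1 n^{-1/3}\le \alpha\le c_2 n^{-1/3}$$ and for which there are at least $100\,\alpha^3|G|^2$ solutions to $xy=z$ with $x,y,z\in X$, i.e. $$\#\{(x,y,z)\in X^3: xy=z\}\ \ge\ 100\,\alpha^3|G|^2 .$$
   Context: $S_n$ is the symmetric group on $\{1,\dots,n\}$; a subgroup $G\le S_n$ is transitive if it acts transitively on $\{1,\dots,n\}$. *)

theory Defs
  imports Complex_Main "HOL-Algebra.Sym_Groups" "HOL-Algebra.Group_Action"
begin

(* A group_action takes its values in BijGroup {1..n}, whose elements are undefined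
   outside {1..n}, whereas permutations fix all points outside {1..n}; hence the restrict. *)
definition transitive_subgroup :: "nat \<Rightarrow> (nat \<Rightarrow> nat) set \<Rightarrow> bool" where
  "transitive_subgroup n G \<longleftrightarrow>
     subgroup G (sym_group n) \<and>
     transitive_action (sym_group n \<lparr>carrier := G\<rparr>) {1..n} (\<lambda>g. restrict g {1..n})"

lemma transitive_subgroup_iff:
  "transitive_subgroup n G \<longleftrightarrow>
     subgroup G (sym_group n) \<and> (\<forall>i\<in>{1..n}. \<forall>j\<in>{1..n}. \<exists>g\<in>G. g i = j)"
proof (cases "subgroup G (sym_group n)")
  case True
  let ?H = "sym_group n \<lparr>carrier := G\<rparr>"
  have perm: "g permutes {1..n}" if "g \<in> G" for g
    using subgroup.subset[OF True] that sym_group_carrier by blast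
  have hom: "(\<lambda>g. restrict g {1..n}) \<in> hom ?H (BijGroup {1..n})"
  proof (rule homI)
    fix x assume x: "x \<in> carrier ?H"
    then have "bij_betw x {1..n} {1..n}"
      using perm permutes_imp_bij by fastforce
    then show "restrict x {1..n} \<in> carrier (BijGroup {1..n})"
      by (simp add: BijGroup_def Bij_def bij_betw_restrict_eq)
    fix y assume y: "y \<in> carrier ?H"
    then have yb: "bij_betw y {1..n} {1..n}"
      using perm permutes_imp_bij by fastforce
    with \<open>bij_betw x {1..n} {1..n}\<close>
    have B: "restrict x {1..n} \<in> Bij {1..n}" "restrict y {1..n} \<in> Bij {1..n}"
      by (simp_all add: Bij_def bij_betw_restrict_eq)
    have "y i \<in> {1..n}" if "i \<in> {1..n}" for i
      using yb that bij_betw_apply by metis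
    then show "restrict (x \<otimes>\<^bsub>?H\<^esub> y) {1..n} =
        restrict x {1..n} \<otimes>\<^bsub>BijGroup {1..n}\<^esub> restrict y {1..n}"
      using B by (auto simp: BijGroup_def sym_group_def compose_def restrict_def)
  qed
  have "group_action ?H {1..n} (\<lambda>g. restrict g {1..n})"
    using hom subgroup.subgroup_is_group[OF True sym_group_is_group] group_BijGroup
    by (simp add: group_action_def group_hom_def group_hom_axioms_def)
  then show ?thesis
    using True
    by (auto simp: transitive_subgroup_def transitive_action_def transitive_action_axioms_def)
qed (simp add: transitive_subgroup_def)

end

theory Submission
  imports Defs
begin

text \<open>
  Fix \<open>s\<close> of order \<open>n\<^sup>1\<^sup>/\<^sup>3\<close> and sets \<open>A, B, C\<close> of \<open>s\<close> points each, and let \<open>X\<^sub>0\<close> consist of all \<open>g \<in> G\<close>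
  for which \<open>g A\<close> meets \<open>B\<close>, or \<open>g B\<close> meets \<open>C\<close>, or \<open>g A\<close> meets \<open>C\<close>. By transitivity, a random
  \<open>g\<close> maps a given point to a given point with probability \<open>1/n\<close>, so the density of \<open>X\<^sub>0\<close> is at most
  \<open>3 s\<^sup>2 / n\<close>, which is of order \<open>n\<^sup>-\<^sup>1\<^sup>/\<^sup>3\<close>. If \<open>y\<close> maps a point of \<open>A\<close> to a point of \<open>B\<close> that \<open>x\<close>
  maps into \<open>C\<close>, then \<open>x\<close>, \<open>y\<close> and \<open>x y\<close> all lie in \<open>X\<^sub>0\<close>. Heuristically there are \<open>s\<^sup>3\<close> such
  configurations, each of probability \<open>1/n\<^sup>2\<close>, so the proportion of pairs \<open>(x, y)\<close> that
  give a solution is of order \<open>s\<^sup>3 / n\<^sup>2\<close>. The cube of the density is at most \<open>27 s\<^sup>6 / n\<^sup>3\<close>, smaller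
  by a factor of order \<open>s\<^sup>3 / n\<close>, and this factor is made as small as desired by taking \<open>s\<close> to be
  a small constant times \<open>n\<^sup>1\<^sup>/\<^sup>3\<close>.

  For an arbitrary transitive group the configurations may overlap badly for particular sets, so
  \<open>B\<close> and \<open>C\<close> are chosen at random among the \<open>s\<close>-subsets. For each fixed pair
  \<open>(x, y)\<close>, whatever the two permutations are, the number of \<open>v \<in> y A \<inter> B\<close> with \<open>x v \<in> C\<close> has mean
  \<open>s\<^sup>3 / n\<^sup>2\<close>, and the expected number of ordered pairs of distinct such \<open>v\<close> is at most the square of
  this, hence negligible because the mean is small (\<open>many_pairs_of_subsets_meet\<close>). Averaging over \<open>(x, y)\<close> gives sets \<open>B, C\<close>
  that work (\<open>exists_sets_many_paths\<close>).

  A lower bound on the density of \<open>X\<^sub>0\<close> itself is avoided: enlarging a set can only create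
  solutions, so \<open>X\<^sub>0\<close> is padded to a set of size \<open>\<lfloor>3 s\<^sup>2 |G| / n\<rfloor>\<close> (\<open>exists_dense_set_many_products\<close>).
\<close>

section \<open>Averaging over subsets of a fixed size\<close>

abbreviation subsets_of_card :: "'a set \<Rightarrow> nat \<Rightarrow> 'a set set" where
  "subsets_of_card U s \<equiv> {A. A \<subseteq> U \<and> card A = s}"

lemma finite_subsets_of_card: "finite U \<Longrightarrow> finite (subsets_of_card U s)"
  by (rule finite_subset[of _ "Pow U"]) auto

text \<open>Removing \<open>D\<close> identifies the \<open>s\<close>-subsets above \<open>D\<close> with the subsets of \<open>U - D\<close> of the remaining size.\<close>

lemma card_subsets_of_card_superset:
  assumes "finite U" "D \<subseteq> U" "card D \<le> s"
  shows "card {A \<in> subsets_of_card U s. D \<subseteq> A} = (card U - card D) choose (s - card D)"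
proof -
  have fD: "finite D" using assms finite_subset by blast
  have "bij_betw (\<lambda>A. A \<union> D) (subsets_of_card (U - D) (s - card D))
          {A \<in> subsets_of_card U s. D \<subseteq> A}"
  proof (rule bij_betwI[where g = "\<lambda>A. A - D"])
    show "(\<lambda>A. A \<union> D) \<in> subsets_of_card (U - D) (s - card D) \<rightarrow> {A \<in> subsets_of_card U s. D \<subseteq> A}"
    proof
      fix A assume A: "A \<in> subsets_of_card (U - D) (s - card D)"
      then have "finite A" using assms(1) by (auto intro: finite_subset)
      then have "card (A \<union> D) = card A + card D"
        using A fD by (intro card_Un_disjoint) auto
      then show "A \<union> D \<in> {A \<in> subsets_of_card U s. D \<subseteq> A}" using A assms by auto
    qed
    show "(\<lambda>A. A - D) \<in> {A \<in> subsets_of_card U s. D \<subseteq> A} \<rightarrow> subsets_of_card (U - D) (s - card D)"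
      using fD by (auto simp: card_Diff_subset)
  qed auto
  then have "card {A \<in> subsets_of_card U s. D \<subseteq> A} = card (subsets_of_card (U - D) (s - card D))"
    by (rule bij_betw_same_card[symmetric])
  also have "\<dots> = (card U - card D) choose (s - card D)"
    using assms fD by (simp add: n_subsets card_Diff_subset)
  finally show ?thesis .
qed

lemma card_subsets_of_card_containing:
  assumes "finite U" "v \<in> U" "s > 0"
  shows "real (card {A \<in> subsets_of_card U s. v \<in> A})
           = real s / real (card U) * real (card (subsets_of_card U s))"
proof -
  define n where "n = card U"
  have n: "n > 0" using assms card_gt_0_iff by (auto simp: n_def)
  have "card {A \<in> subsets_of_card U s. v \<in> A} = (n - 1) choose (s - 1)"
    using card_subsets_of_card_superset[of U "{v}" s] assms(2,3)
    by (simp add: assms(1) Suc_le_eq n_def)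
  moreover have "s * (n choose s) = n * ((n - 1) choose (s - 1))"
    by (rule times_binomial_minus1_eq[OF assms(3)])
  then have "real s * real (n choose s) = real n * real ((n - 1) choose (s - 1))"
    by (simp only: flip: of_nat_mult)
  then have "real ((n - 1) choose (s - 1)) = real s / real n * real (n choose s)"
    using n by (simp add: field_simps)
  ultimately show ?thesis unfolding n_subsets[OF assms(1)] by (simp only: n_def)
qed

text \<open>The events \<open>v \<in> A\<close> and \<open>w \<in> A\<close> are negatively correlated, because the size of \<open>A\<close> is fixed.\<close>

lemma card_subsets_of_card_containing_pair:
  assumes "finite U" "v \<in> U" "w \<in> U" "v \<noteq> w" "s > 0" "s \<le> card U"
  shows "real (card {A \<in> subsets_of_card U s. v \<in> A \<and> w \<in> A})
           \<le> (real s / real (card U))\<^sup>2 * real (card (subsets_of_card U s))"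
proof (cases "s = 1")
  \<comment> \<open>Truncated subtraction makes the binomial formula below wrong for \<open>s = 1\<close>.\<close>
  case True
  then have "{A \<in> subsets_of_card U s. v \<in> A \<and> w \<in> A} = {}"
    using assms(4) by (auto simp: card_1_singleton_iff)
  then show ?thesis by (simp only: card.empty of_nat_0) simp
next
  case False
  define n where "n = card U"
  have s: "s \<ge> 2" "n \<ge> 2" using False assms by (auto simp: n_def)
  have "{A \<in> subsets_of_card U s. v \<in> A \<and> w \<in> A} = {A \<in> subsets_of_card U s. {v,w} \<subseteq> A}"
    by auto
  then have c: "card {A \<in> subsets_of_card U s. v \<in> A \<and> w \<in> A} = (n - 2) choose (s - 2)"
    using card_subsets_of_card_superset[of U "{v,w}" s] assms s by (simp add: n_def numeral_2_eq_2)
  have "s * (n choose s) = n * ((n - 1) choose (s - 1))"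
    using s by (intro times_binomial_minus1_eq) auto
  then have 1: "real ((n - 1) choose (s - 1)) = real s / real n * real (n choose s)"
    using s by (simp add: field_simps flip: of_nat_mult)
  have "(s - 1) * ((n - 1) choose (s - 1)) = (n - 1) * ((n - 1 - 1) choose (s - 1 - 1))"
    using s by (intro times_binomial_minus1_eq) auto
  then have "real (s - 1) * real ((n - 1) choose (s - 1)) = real (n - 1) * real ((n - 2) choose (s - 2))"
    by (simp only: diff_diff_left one_add_one flip: of_nat_mult)
  moreover have "real (n - 1) \<noteq> 0" using s by simp
  ultimately have
    "real ((n - 2) choose (s - 2)) = real (s - 1) / real (n - 1) * real ((n - 1) choose (s - 1))"
    by (subst times_divide_eq_left, subst nonzero_eq_divide_eq) (simp_all only: mult.commute)
  also have "\<dots> \<le> real s / real n * real ((n - 1) choose (s - 1))"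
    using s assms(6) by (intro mult_right_mono) (auto simp: field_simps of_nat_diff n_def)
  also have "\<dots> = (real s / real n)\<^sup>2 * real (n choose s)"
    unfolding 1 by (simp add: power2_eq_square)
  finally show ?thesis
    unfolding c n_subsets[OF assms(1)] by (simp only: n_def)
qed

text \<open>
  A cheap second Bonferroni inequality: with \<open>m = card M\<close> the left-hand side is
  \<open>m - m (m - 1) = 1 - (m - 1)\<^sup>2\<close>, which is at most \<open>1\<close> and vanishes for \<open>m = 0\<close>. Unlike the indicator
  itself, both terms on the left become easy to average.
\<close>

lemma of_bool_nonempty_ge_card_minus_pairs:
  assumes "finite M"
  shows "real (card M) - real (card {(v, w) \<in> M \<times> M. v \<noteq> w}) \<le> of_bool (M \<noteq> {})"
proof (cases "M = {}")
  case False
  have "{(v, w) \<in> M \<times> M. v \<noteq> w} = M \<times> M - (\<lambda>v. (v, v)) ` M" by auto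
  then have "card {(v, w) \<in> M \<times> M. v \<noteq> w} = card M * card M - card M"
    using assms
    by (simp add: card_Diff_subset card_cartesian_product card_image inj_on_def image_subset_iff)
  then have "real (card {(v, w) \<in> M \<times> M. v \<noteq> w}) = real (card M) * real (card M) - real (card M)"
    by (simp add: of_nat_diff)
  moreover have "0 \<le> (real (card M) - 1)\<^sup>2" by simp
  ultimately show ?thesis using False by (simp add: power2_eq_square algebra_simps)
qed simp

lemma sum_of_bool_conj_product:
  assumes "finite F" "finite H"
  shows "(\<Sum>A\<in>F. \<Sum>B\<in>H. of_bool (P A \<and> Q B)) = real (card {A\<in>F. P A}) * real (card {B\<in>H. Q B})"
proof -
  have "(\<Sum>A\<in>F. \<Sum>B\<in>H. of_bool (P A \<and> Q B))
      = (\<Sum>A\<in>F. of_bool (P A)) * (\<Sum>B\<in>H. of_bool (Q B) :: real)"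
    by (simp add: of_bool_conj sum_product)
  then show ?thesis using assms by (simp add: Int_def)
qed

text \<open>
  Here \<open>A\<close> and \<open>B\<close> are independent random \<open>s\<close>-subsets, each containing a given point with
  probability \<open>p\<close>. The main term \<open>s p\<^sup>2\<close> is the expected number of \<open>v\<close>. The error term bounds the
  expected number of ordered pairs of distinct such \<open>v\<close>: there are at most \<open>s\<^sup>2\<close> pairs in \<open>C\<close>, and since
  \<open>x\<close> is injective, each costs at most \<open>p\<^sup>2\<close> for \<open>A\<close> and \<open>p\<^sup>2\<close> for \<open>B\<close>.
\<close>

lemma many_pairs_of_subsets_meet:
  fixes x :: "'a \<Rightarrow> 'a"
  assumes U: "finite U" and C: "C \<subseteq> U" "card C = s" and x: "inj_on x U" "x ` U \<subseteq> U"
    and s: "s > 0"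
  defines "F \<equiv> subsets_of_card U s" and "p \<equiv> real s / real (card U)"
  shows "(real s * p\<^sup>2 - (real s)\<^sup>2 * p ^ 4) * (real (card F))\<^sup>2
           \<le> (\<Sum>A\<in>F. \<Sum>B\<in>F. of_bool (\<exists>v\<in>C. v \<in> A \<and> x v \<in> B))"
proof -
  define M where "M A B = {v \<in> C. v \<in> A \<and> x v \<in> B}" for A B
  define O2 where "O2 = {(v, w) \<in> C \<times> C. v \<noteq> w}"
  have fC: "finite C" using U C finite_subset by blast
  have fF: "finite F" unfolding F_def by (rule finite_subsets_of_card[OF U])
  have fM: "finite (M A B)" for A B using fC by (simp add: M_def)
  have fO: "finite O2" unfolding O2_def using fC by (auto intro: finite_subset[of _ "C \<times> C"])
  have sU: "s \<le> card U" using C U card_mono by blast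
  have cM: "real (card (M A B)) = (\<Sum>v\<in>C. of_bool (v \<in> A \<and> x v \<in> B))" for A B
    using fC by (simp add: M_def Int_def)
  have cO: "real (card {(v, w) \<in> M A B \<times> M A B. v \<noteq> w})
      = (\<Sum>e\<in>O2. of_bool ((fst e \<in> A \<and> snd e \<in> A) \<and> (x (fst e) \<in> B \<and> x (snd e) \<in> B)))" for A B
  proof -
    have "{(v, w) \<in> M A B \<times> M A B. v \<noteq> w}
       = O2 \<inter> {e. (fst e \<in> A \<and> snd e \<in> A) \<and> (x (fst e) \<in> B \<and> x (snd e) \<in> B)}"
      by (auto simp: M_def O2_def)
    then show ?thesis using fO by simp
  qed
  have first: "(\<Sum>A\<in>F. \<Sum>B\<in>F. real (card (M A B))) = real s * p\<^sup>2 * (real (card F))\<^sup>2"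
  proof -
    have "(\<Sum>A\<in>F. \<Sum>B\<in>F. real (card (M A B)))
        = (\<Sum>v\<in>C. \<Sum>A\<in>F. \<Sum>B\<in>F. of_bool (v \<in> A \<and> x v \<in> B))"
      unfolding cM by (subst sum.swap[of _ C], subst sum.swap[of _ C]) (rule refl)
    also have "\<dots> = (\<Sum>v\<in>C. (p * real (card F)) * (p * real (card F)))"
    proof (rule sum.cong)
      fix v assume "v \<in> C"
      then have "v \<in> U" "x v \<in> U" using C x by auto
      then show "(\<Sum>A\<in>F. \<Sum>B\<in>F. of_bool (v \<in> A \<and> x v \<in> B)) = (p * real (card F)) * (p * real (card F))"
        using card_subsets_of_card_containing[OF U _ s]
        by (simp only: sum_of_bool_conj_product[OF fF fF]) (simp add: F_def p_def)
    qed simp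
    finally show ?thesis using C by (simp add: power2_eq_square)
  qed
  have second: "(\<Sum>A\<in>F. \<Sum>B\<in>F. real (card {(v, w) \<in> M A B \<times> M A B. v \<noteq> w}))
      \<le> (real s)\<^sup>2 * p ^ 4 * (real (card F))\<^sup>2"
  proof -
    have "(\<Sum>A\<in>F. \<Sum>B\<in>F. real (card {(v, w) \<in> M A B \<times> M A B. v \<noteq> w}))
        = (\<Sum>e\<in>O2. \<Sum>A\<in>F. \<Sum>B\<in>F.
            of_bool ((fst e \<in> A \<and> snd e \<in> A) \<and> (x (fst e) \<in> B \<and> x (snd e) \<in> B)))"
      unfolding cO by (subst sum.swap[of _ O2], subst sum.swap[of _ O2]) (rule refl)
    also have "\<dots> \<le> (\<Sum>e\<in>O2. (p\<^sup>2 * real (card F)) * (p\<^sup>2 * real (card F)))"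
    proof (rule sum_mono)
      fix e assume e: "e \<in> O2"
      obtain v w where vw: "e = (v, w)" by fastforce
      have 1: "v \<in> U" "w \<in> U" "v \<noteq> w" and 2: "x v \<in> U" "x w \<in> U" "x v \<noteq> x w"
        using C x e vw by (auto simp: O2_def dest: inj_onD)
      show "(\<Sum>A\<in>F. \<Sum>B\<in>F. of_bool ((fst e \<in> A \<and> snd e \<in> A) \<and> (x (fst e) \<in> B \<and> x (snd e) \<in> B)))
          \<le> (p\<^sup>2 * real (card F)) * (p\<^sup>2 * real (card F))"
        unfolding sum_of_bool_conj_product[OF fF fF]
        using card_subsets_of_card_containing_pair[OF U 1 s sU]
          card_subsets_of_card_containing_pair[OF U 2 s sU]
        by (intro mult_mono) (simp_all add: vw F_def p_def)
    qed
    also have "\<dots> = real (card O2) * (p ^ 4 * (real (card F))\<^sup>2)"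
      by (simp add: power2_eq_square power4_eq_xxxx)
    also have "\<dots> \<le> (real s)\<^sup>2 * (p ^ 4 * (real (card F))\<^sup>2)"
    proof (rule mult_right_mono)
      have "card O2 \<le> card (C \<times> C)" unfolding O2_def using fC by (intro card_mono) auto
      then show "real (card O2) \<le> (real s)\<^sup>2"
        using C by (simp add: card_cartesian_product power2_eq_square flip: of_nat_mult)
    qed simp
    finally show ?thesis by (simp add: mult.assoc)
  qed
  have "(real s * p\<^sup>2 - (real s)\<^sup>2 * p ^ 4) * (real (card F))\<^sup>2
      \<le> (\<Sum>A\<in>F. \<Sum>B\<in>F. real (card (M A B)) - real (card {(v, w) \<in> M A B \<times> M A B. v \<noteq> w}))"
    using first second by (simp add: sum_subtractf algebra_simps)
  also have "\<dots> \<le> (\<Sum>A\<in>F. \<Sum>B\<in>F. of_bool (M A B \<noteq> {}))"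
    by (intro sum_mono of_bool_nonempty_ge_card_minus_pairs fM)
  also have "\<dots> = (\<Sum>A\<in>F. \<Sum>B\<in>F. of_bool (\<exists>v\<in>C. v \<in> A \<and> x v \<in> B))"
    by (intro sum.cong arg_cong[where f = of_bool]) (auto simp: M_def)
  finally show ?thesis .
qed

lemma exists_ge_average:
  fixes f :: "'a \<Rightarrow> real"
  assumes "finite S" "S \<noteq> {}" "c * real (card S) \<le> sum f S"
  shows "\<exists>a\<in>S. c \<le> f a"
proof (rule ccontr)
  assume "\<not> ?thesis"
  then have "sum f S < (\<Sum>a\<in>S. c)" using assms by (intro sum_strict_mono) auto
  then show False using assms by (simp add: mult.commute)
qed

text \<open>
  The bound of \<open>many_pairs_of_subsets_meet\<close>, applied to the set \<open>y ` A\<close>, is uniform in \<open>x\<close> and \<open>y\<close>. Exchanging the sums over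
  pairs of permutations and pairs of sets therefore produces one choice of \<open>B\<close> and \<open>C\<close> that is at
  least as good as the average.
\<close>

lemma exists_sets_many_paths:
  fixes G :: "('a \<Rightarrow> 'a) set"
  assumes U: "finite U" and G: "finite G" "\<And>g. g \<in> G \<Longrightarrow> g permutes U"
    and A: "A \<subseteq> U" "card A = s" and s: "s > 0"
  defines "p \<equiv> real s / real (card U)"
  obtains B C where "B \<subseteq> U" "card B = s" "C \<subseteq> U" "card C = s"
    "(real s * p\<^sup>2 - (real s)\<^sup>2 * p ^ 4) * (real (card G))\<^sup>2
       \<le> real (card {(x, y) \<in> G \<times> G. \<exists>i\<in>A. y i \<in> B \<and> x (y i) \<in> C})"
proof -
  define F where "F = subsets_of_card U s"
  define c where "c = real s * p\<^sup>2 - (real s)\<^sup>2 * p ^ 4"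
  define f where "f BC = real (card {(x, y) \<in> G \<times> G. \<exists>i\<in>A. y i \<in> fst BC \<and> x (y i) \<in> snd BC})" for BC
  have fF: "finite F" unfolding F_def by (rule finite_subsets_of_card[OF U])
  have F0: "F \<noteq> {}" using A by (auto simp: F_def)
  have f_eq: "f BC = (\<Sum>(x, y)\<in>G \<times> G. of_bool (\<exists>v\<in>y ` A. v \<in> fst BC \<and> x v \<in> snd BC))" for BC
  proof -
    have "{(x, y) \<in> G \<times> G. \<exists>i\<in>A. y i \<in> fst BC \<and> x (y i) \<in> snd BC}
        = G \<times> G \<inter> {e. \<exists>v\<in>snd e ` A. v \<in> fst BC \<and> fst e v \<in> snd BC}" by auto
    then show ?thesis using G by (simp add: f_def case_prod_unfold)
  qed
  have "c * (real (card G))\<^sup>2 * real (card (F \<times> F))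
      = (\<Sum>(x, y)\<in>G \<times> G. c * (real (card F))\<^sup>2)"
    by (simp add: card_cartesian_product power2_eq_square)
  also have "\<dots> \<le> (\<Sum>(x, y)\<in>G \<times> G. \<Sum>B\<in>F. \<Sum>C\<in>F. of_bool (\<exists>v\<in>y ` A. v \<in> B \<and> x v \<in> C))"
  proof (rule sum_mono, clarify)
    fix x y assume "x \<in> G" "y \<in> G"
    then have xy: "x permutes U" "y permutes U" using G by auto
    show "c * (real (card F))\<^sup>2 \<le> (\<Sum>B\<in>F. \<Sum>C\<in>F. of_bool (\<exists>v\<in>y ` A. v \<in> B \<and> x v \<in> C))"
      unfolding c_def p_def F_def
    proof (rule many_pairs_of_subsets_meet[OF U _ _ _ _ s])
      show "y ` A \<subseteq> U" using A permutes_image[OF xy(2)] by blast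
      show "card (y ` A) = s"
        using A card_image[OF inj_on_subset[OF permutes_inj[OF xy(2)]]] by simp
      show "inj_on x U" using permutes_inj_on[OF xy(1)] .
      show "x ` U \<subseteq> U" using permutes_image[OF xy(1)] by simp
    qed
  qed
  also have "\<dots> = (\<Sum>e\<in>G \<times> G. \<Sum>BC\<in>F \<times> F. of_bool (\<exists>v\<in>snd e ` A. v \<in> fst BC \<and> fst e v \<in> snd BC))"
    by (simp add: sum.cartesian_product case_prod_unfold)
  also have "\<dots> = (\<Sum>BC\<in>F \<times> F. f BC)"
    unfolding f_eq by (subst sum.swap) (simp add: case_prod_unfold)
  finally obtain BC where "BC \<in> F \<times> F" "c * (real (card G))\<^sup>2 \<le> f BC"
    using exists_ge_average[of "F \<times> F" "c * (real (card G))\<^sup>2" f] fF F0 by blast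
  then show ?thesis by (intro that[of "fst BC" "snd BC"]) (auto simp: F_def f_def c_def)
qed

section \<open>Transitivity and density\<close>

lemma transitive_subgroup_permutations:
  assumes "transitive_subgroup n G"
  shows "finite G" "\<And>g. g \<in> G \<Longrightarrow> g permutes {1..n}" "\<And>g h. g \<in> G \<Longrightarrow> h \<in> G \<Longrightarrow> g \<circ> h \<in> G" "G \<noteq> {}"
proof -
  have sg: "subgroup G (sym_group n)" using assms by (simp add: transitive_subgroup_def)
  show perm: "g permutes {1..n}" if "g \<in> G" for g
    using subgroup.subset[OF sg] that sym_group_carrier by blast
  show "finite G"
    using perm finite_permutations[of "{1..n}"]
    by (auto intro: finite_subset[of G "{p. p permutes {1..n}}"])
  show "g \<circ> h \<in> G" if "g \<in> G" "h \<in> G" for g h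
    using subgroup.m_closed[OF sg that] by (simp add: sym_group_def)
  show "G \<noteq> {}" using subgroup.one_closed[OF sg] by blast
qed

text \<open>
  Left multiplication by an element that maps \<open>k\<close> to \<open>l\<close> embeds the fibre over \<open>k\<close> of the
  evaluation \<open>g \<mapsto> g i\<close> into the fibre over \<open>l\<close>, so all \<open>n\<close> fibres have the same size.
\<close>

lemma transitive_card_fibre:
  assumes "transitive_subgroup n G" "i \<in> {1..n}" "j \<in> {1..n}"
  shows "n * card {g \<in> G. g i = j} = card G"
proof -
  let ?fib = "\<lambda>j. {g \<in> G. g i = j}"
  have tr: "\<exists>g\<in>G. g k = l" if "k \<in> {1..n}" "l \<in> {1..n}" for k l
    using assms(1) that by (simp add: transitive_subgroup_iff)
  note fG = transitive_subgroup_permutations(1)[OF assms(1)]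
    and perm = transitive_subgroup_permutations(2)[OF assms(1)]
    and comp = transitive_subgroup_permutations(3)[OF assms(1)]
  have le: "card (?fib k) \<le> card (?fib l)" if kl: "k \<in> {1..n}" "l \<in> {1..n}" for k l
  proof -
    obtain g where g: "g \<in> G" "g k = l" using tr kl by blast
    have "inj_on ((\<circ>) g) (?fib k)"
      using fun.inj_map[OF permutes_inj[OF perm[OF g(1)]]] by (rule inj_on_subset) simp
    moreover have "(\<circ>) g ` ?fib k \<subseteq> ?fib l" using g comp by auto
    ultimately show ?thesis using fG by (intro card_inj_on_le) auto
  qed
  have "G = (\<Union>k\<in>{1..n}. ?fib k)"
  proof -
    have "g i \<in> {1..n}" if "g \<in> G" for g using permutes_in_image[OF perm[OF that]] assms(2) by blast
    then show ?thesis by auto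
  qed
  then have "card G = card (\<Union>k\<in>{1..n}. ?fib k)" by simp
  also have "\<dots> = (\<Sum>k\<in>{1..n}. card (?fib k))"
    using fG by (intro card_UN_disjoint) auto
  also have "\<dots> = (\<Sum>k\<in>{1..n}. card (?fib j))"
    using le assms(3) by (intro sum.cong refl antisym) auto
  finally show ?thesis by simp
qed

lemma transitive_card_maps_some_pair:
  assumes "transitive_subgroup n G" "E \<subseteq> {1..n} \<times> {1..n}"
  shows "n * card {g \<in> G. \<exists>(i, j)\<in>E. g i = j} \<le> card E * card G"
proof -
  have fE: "finite E" using assms(2) finite_subset by blast
  have "{g \<in> G. \<exists>(i, j)\<in>E. g i = j} = (\<Union>e\<in>E. {g \<in> G. g (fst e) = snd e})" by auto
  then have "n * card {g \<in> G. \<exists>(i, j)\<in>E. g i = j} \<le> n * (\<Sum>e\<in>E. card {g \<in> G. g (fst e) = snd e})"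
    using card_UN_le[OF fE, of "\<lambda>e. {g \<in> G. g (fst e) = snd e}"] by simp
  also have "\<dots> = (\<Sum>e\<in>E. card G)"
    unfolding sum_distrib_left
    using transitive_card_fibre[OF assms(1)] assms(2) by (intro sum.cong) auto
  finally show ?thesis by simp
qed

text \<open>
  The pairs in \<open>A \<times> B\<close>, \<open>B \<times> C\<close> and \<open>A \<times> C\<close> are the edges of a tripartite graph, and \<open>X\<^sub>0\<close> consists
  of the group elements that move some point along an edge. A triangle \<open>i, y i, x (y i)\<close> makes \<open>y\<close>,
  \<open>x\<close> and \<open>x \<circ> y\<close> members of \<open>X\<^sub>0\<close> simultaneously.
\<close>

lemma exists_dense_set_many_products:
  assumes tr: "transitive_subgroup n G" and s: "s > 0" "3 * s ^ 3 \<le> n"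
  obtains X where "X \<subseteq> G" "card X = 3 * s\<^sup>2 * card G div n"
    "(real s) ^ 3 / (2 * (real n)\<^sup>2) * (real (card G))\<^sup>2
      \<le> real (card {(x, y, z). x \<in> X \<and> y \<in> X \<and> z \<in> X \<and> x \<otimes>\<^bsub>sym_group n\<^esub> y = z})"
proof -
  note sg = transitive_subgroup_permutations[OF tr]
  have s3: "s\<^sup>2 \<le> s ^ 3" "s \<le> s ^ 3" using s by (auto intro: power_increasing self_le_power)
  have sn: "s \<le> n" "3 * s\<^sup>2 \<le> n" "n > 0" using s s3 by linarith+
  define p where "p = real s / real n"
  define A where "A = {1..s}"
  have A: "A \<subseteq> {1..n}" "card A = s" using sn by (auto simp: A_def)
  obtain B C where B: "B \<subseteq> {1..n}" "card B = s" and C: "C \<subseteq> {1..n}" "card C = s"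
    and many: "(real s * p\<^sup>2 - (real s)\<^sup>2 * p ^ 4) * (real (card G))\<^sup>2
       \<le> real (card {(x, y) \<in> G \<times> G. \<exists>i\<in>A. y i \<in> B \<and> x (y i) \<in> C})"
    using exists_sets_many_paths[OF finite_atLeastAtMost sg(1,2) A s(1),
        unfolded card_atLeastAtMost diff_Suc_1, folded p_def] by blast
  define E where "E = A \<times> B \<union> B \<times> C \<union> A \<times> C"
  define X\<^sub>0 where "X\<^sub>0 = {g \<in> G. \<exists>(i, j)\<in>E. g i = j}"
  have "card E \<le> card (A \<times> B) + card (B \<times> C) + card (A \<times> C)"
    unfolding E_def by (meson add_mono card_Un_le le_refl le_trans)
  then have cE: "card E \<le> 3 * s\<^sup>2"
    using A B C by (simp add: card_cartesian_product power2_eq_square)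
  have "n * card X\<^sub>0 \<le> card E * card G"
    unfolding X\<^sub>0_def using A B C by (intro transitive_card_maps_some_pair[OF tr]) (auto simp: E_def)
  also have "\<dots> \<le> 3 * s\<^sup>2 * card G" using cE by (rule mult_le_mono1)
  finally have "card X\<^sub>0 \<le> 3 * s\<^sup>2 * card G div n"
    using sn by (simp add: less_eq_div_iff_mult_less_eq mult.commute)
  \<comment> \<open>There is room for the padding: the target size lies between \<open>card X\<^sub>0\<close> and \<open>card G\<close>.\<close>
  moreover have "3 * s\<^sup>2 * card G div n \<le> n * card G div n"
    using sn by (intro div_le_mono mult_le_mono1)
  then have "3 * s\<^sup>2 * card G div n \<le> card G" using sn by simp
  moreover have "X\<^sub>0 \<subseteq> G" by (auto simp: X\<^sub>0_def)
  ultimately obtain X where X: "X\<^sub>0 \<subseteq> X" "X \<subseteq> G" "card X = 3 * s\<^sup>2 * card G div n"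
    using exists_subset_between[OF _ _ _ sg(1), of X\<^sub>0 "3 * s\<^sup>2 * card G div n"] by blast
  let ?Sol = "{(x, y, z). x \<in> X \<and> y \<in> X \<and> z \<in> X \<and> x \<otimes>\<^bsub>sym_group n\<^esub> y = z}"
  let ?P = "{(x, y) \<in> G \<times> G. \<exists>i\<in>A. y i \<in> B \<and> x (y i) \<in> C}"
  have "card ?P \<le> card ?Sol"
  proof (rule card_inj_on_le)
    show "inj_on (\<lambda>(x, y). (x, y, x \<circ> y)) ?P" by (auto simp: inj_on_def)
    show "(\<lambda>(x, y). (x, y, x \<circ> y)) ` ?P \<subseteq> ?Sol"
    proof clarify
      fix x y i assume *: "x \<in> G" "y \<in> G" "i \<in> A" "y i \<in> B" "x (y i) \<in> C"
      then have "x \<in> X\<^sub>0" "y \<in> X\<^sub>0" "x \<circ> y \<in> X\<^sub>0"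
        using sg(3)[of x y] by (force simp: X\<^sub>0_def E_def)+
      then show "x \<in> X \<and> y \<in> X \<and> x \<circ> y \<in> X \<and> x \<otimes>\<^bsub>sym_group n\<^esub> y = x \<circ> y"
        using X by (auto simp: sym_group_def)
    qed
    have "finite X" using X sg(1) finite_subset by blast
    then show "finite ?Sol" by (auto intro: finite_subset[of _ "X \<times> X \<times> X"])
  qed
  moreover have "(real s) ^ 3 / (2 * (real n)\<^sup>2) \<le> real s * p\<^sup>2 - (real s)\<^sup>2 * p ^ 4"
  proof -
    \<comment> \<open>The error term is the square of the main term \<open>q\<close>, and \<open>q \<le> 1/2\<close>.\<close>
    define q where "q = (real s) ^ 3 / (real n)\<^sup>2"
    have "2 * s ^ 3 \<le> n\<^sup>2" using s sn self_le_power[of n 2] by linarith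
    then have "real (2 * s ^ 3) \<le> real (n\<^sup>2)" by (simp only: of_nat_le_iff)
    then have q: "0 \<le> q" "q \<le> 1 / 2" using sn by (auto simp: q_def field_simps)
    have "real s * p\<^sup>2 - (real s)\<^sup>2 * p ^ 4 = q - q * q"
      by (simp add: p_def q_def field_simps power2_eq_square power3_eq_cube power4_eq_xxxx)
    moreover have "q * q \<le> q * (1 / 2)" using q by (intro mult_left_mono)
    ultimately show ?thesis by (simp add: q_def)
  qed
  then have "(real s) ^ 3 / (2 * (real n)\<^sup>2) * (real (card G))\<^sup>2
      \<le> (real s * p\<^sup>2 - (real s)\<^sup>2 * p ^ 4) * (real (card G))\<^sup>2"
    by (rule mult_right_mono) simp
  ultimately show ?thesis using many X by (intro that[of X]) auto
qed

section \<open>Choice of parameters\<close>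

lemma exists_nat_near_cube_root:
  assumes "c > 0" "(n::nat) \<ge> c"
  obtains s :: nat where "s > 0" "c * s ^ 3 \<le> n" "n \<le> 8 * c * s ^ 3"
proof -
  define S where "S = {s. c * s ^ 3 \<le> n}"
  have "s \<le> n" if "s \<in> S" for s
  proof -
    have "s \<le> s ^ 3" by (cases "s = 0") (auto intro: self_le_power)
    also have "\<dots> \<le> c * s ^ 3" using assms by simp
    finally show ?thesis using that by (simp add: S_def)
  qed
  then have fS: "finite S" by (meson finite_nat_set_iff_bounded_le)
  define s where "s = Max S"
  have 1: "1 \<in> S" using assms by (simp add: S_def)
  then have "S \<noteq> {}" by blast
  then have s: "s \<in> S" "s \<ge> 1" unfolding s_def using Max_in[OF fS] Max_ge[OF fS 1] by blast+
  have "Suc s \<notin> S" using Max_ge[OF fS] by (force simp: s_def)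
  then have "n \<le> c * (Suc s) ^ 3" by (simp add: S_def)
  also have "\<dots> \<le> c * (2 * s) ^ 3" using s by (intro mult_left_mono power_mono) auto
  finally show ?thesis using s that[of s] by (simp add: S_def power_mult_distrib mult_ac)
qed

theorem proposition2p2:
  shows "\<exists>(c\<^sub>1::real) (c\<^sub>2::real) (n\<^sub>0::nat). c\<^sub>1 > 0 \<and> c\<^sub>2 > 0 \<and>
    (\<forall>n\<ge>n\<^sub>0. \<forall>G. transitive_subgroup n G \<longrightarrow>
      (\<exists>X\<subseteq>G. \<exists>\<alpha>::real. \<alpha> = real (card X) / real (card G) \<and>
         c\<^sub>1 * real n powr (-1/3) \<le> \<alpha> \<and> \<alpha> \<le> c\<^sub>2 * real n powr (-1/3) \<and>
         real (card {(x, y, z). x \<in> X \<and> y \<in> X \<and> z \<in> X \<and> x \<otimes>\<^bsub>sym_group n\<^esub> y = z})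
           \<ge> 100 * \<alpha> ^ 3 * real (card G) ^ 2))"
proof -
  have "\<exists>X\<subseteq>G. \<exists>\<alpha>::real. \<alpha> = real (card X) / real (card G) \<and>
         1 / 800 * real n powr (-1/3) \<le> \<alpha> \<and> \<alpha> \<le> 3 * real n powr (-1/3) \<and>
         real (card {(x, y, z). x \<in> X \<and> y \<in> X \<and> z \<in> X \<and> x \<otimes>\<^bsub>sym_group n\<^esub> y = z})
           \<ge> 100 * \<alpha> ^ 3 * real (card G) ^ 2"
    if n: "n \<ge> 8000" and tr: "transitive_subgroup n G" for n G
  proof -
    \<comment> \<open>The solution count needs \<open>s\<^sup>3 / (2 n\<^sup>2) \<ge> 100 (3 s\<^sup>2 / n)\<^sup>3\<close>, that is \<open>5400 s\<^sup>3 \<le> n\<close>.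
      The cube \<open>8000 = 20\<^sup>3\<close> is a convenient larger constant: it puts \<open>s n\<^sup>-\<^sup>1\<^sup>/\<^sup>3\<close> between \<open>1/40\<close>
      and \<open>1/20\<close>.\<close>
    obtain s where s: "s > 0" "8000 * s ^ 3 \<le> n" "n \<le> 8 * 8000 * s ^ 3"
      using exists_nat_near_cube_root[of 8000 n] n by auto
    then obtain X where X: "X \<subseteq> G" "card X = 3 * s\<^sup>2 * card G div n"
      and many: "(real s) ^ 3 / (2 * (real n)\<^sup>2) * (real (card G))\<^sup>2
        \<le> real (card {(x, y, z). x \<in> X \<and> y \<in> X \<and> z \<in> X \<and> x \<otimes>\<^bsub>sym_group n\<^esub> y = z})"
      using exists_dense_set_many_products[OF tr, of s] by auto
    define \<alpha> where "\<alpha> = real (card X) / real (card G)"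
    define r where "r = real n powr (-1/3)"
    define d where "d = (real s)\<^sup>2 / real n"
    have n0: "real n > 0" using n by simp
    have r: "r > 0" "r ^ 3 = 1 / real n"
      using n0 powr_power[of "real n" "-1/3" 3] by (simp_all add: r_def powr_minus_divide)
    have G0: "card G > 0"
      using transitive_subgroup_permutations[OF tr] by (simp add: card_gt_0_iff)
    have "card G = n * card {g \<in> G. g 1 = 1}" using transitive_card_fibre[OF tr, of 1 1] n by simp
    then have "n dvd card G" by (rule dvdI)
    then have nG: "n \<le> card G" using G0 by (rule dvd_imp_le)

    have sr: "1 / 40 \<le> real s * r" "real s * r \<le> 1 / 20"
    proof -
      have "real (8000 * s ^ 3) \<le> real n" "real n \<le> real (8 * 8000 * s ^ 3)"
        using s by (simp_all only: of_nat_le_iff)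
      then have "(1 / 40) ^ 3 \<le> (real s * r) ^ 3" "(real s * r) ^ 3 \<le> (1 / 20) ^ 3"
        using n0 by (simp_all add: power_mult_distrib r field_simps)
      then show "1 / 40 \<le> real s * r" "real s * r \<le> 1 / 20"
        using r by (auto intro: power_le_imp_le_base[of _ 2, folded numeral_3_eq_3])
    qed
    have d: "d = (real s * r)\<^sup>2 * r"
    proof -
      have "d = (real s)\<^sup>2 * r ^ 3" by (simp add: d_def r)
      then show ?thesis by (simp add: power2_eq_square power3_eq_cube)
    qed

    have up: "\<alpha> \<le> 3 * d"
    proof -
      have "real (card X) \<le> real (3 * s\<^sup>2 * card G) / real n"
        unfolding X by (rule of_nat_div_le_of_nat)
      then show ?thesis using G0 by (simp add: \<alpha>_def d_def field_simps)
    qed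
    \<comment> \<open>Rounding the size of \<open>X\<close> down costs at most \<open>1 / card G \<le> 1 / n \<le> d\<close>.\<close>
    have low: "2 * d \<le> \<alpha>"
    proof -
      define m where "m = 3 * s\<^sup>2 * card G"
      have "real m / real n = real (m div n) + real (m mod n) / real n"
        by (rule of_nat_of_nat_div_aux)
      moreover have "real (m mod n) / real n \<le> 1" using n0 by simp
      ultimately have "real (3 * s\<^sup>2 * card G) / real n - real (card X) \<le> 1"
        unfolding X m_def by linarith
      then have "(real (3 * s\<^sup>2 * card G) / real n - real (card X)) / real (card G) \<le> 1 / real (card G)"
        by (rule divide_right_mono) simp
      moreover have "(real (3 * s\<^sup>2 * card G) / real n - real (card X)) / real (card G) = 3 * d - \<alpha>"
        using G0 by (simp add: \<alpha>_def d_def diff_divide_distrib)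
      ultimately have "3 * d - \<alpha> \<le> 1 / real (card G)" by simp
      also have "\<dots> \<le> 1 / real n" using nG n0 by (simp add: field_simps)
      also have "\<dots> \<le> d" using s n0 by (simp add: d_def field_simps)
      finally show ?thesis by simp
    qed

    have "1 / 800 * r \<le> 2 * d"
    proof -
      have "(1 / 40)\<^sup>2 \<le> (real s * r)\<^sup>2" using sr by (intro power_mono) auto
      then have "(1 / 40)\<^sup>2 * r \<le> d" unfolding d using r by (intro mult_right_mono) auto
      then show ?thesis by (simp add: power2_eq_square)
    qed
    moreover have "3 * d \<le> 3 * r"
    proof -
      have "(real s * r)\<^sup>2 \<le> 1\<^sup>2" using sr by (intro power_mono) auto
      then have "d \<le> 1 * r" unfolding d using r by (intro mult_right_mono) auto
      then show ?thesis by simp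
    qed
    moreover have "100 * \<alpha> ^ 3 \<le> (real s) ^ 3 / (2 * (real n)\<^sup>2)"
    proof -
      have "\<alpha> ^ 3 \<le> (3 * d) ^ 3" using up by (intro power_mono) (auto simp: \<alpha>_def)
      moreover have "5400 * d ^ 3 \<le> (real s) ^ 3 / (real n)\<^sup>2"
      proof -
        have "real (8000 * s ^ 3) \<le> real n" using s by (simp only: of_nat_le_iff)
        then have "5400 * (real s) ^ 3 / real n \<le> 1" using n0 by (simp add: field_simps)
        then have "(5400 * (real s) ^ 3 / real n) * ((real s) ^ 3 / (real n)\<^sup>2)
            \<le> 1 * ((real s) ^ 3 / (real n)\<^sup>2)"
          by (rule mult_right_mono) simp
        moreover have "5400 * d ^ 3 = (5400 * (real s) ^ 3 / real n) * ((real s) ^ 3 / (real n)\<^sup>2)"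
          by (simp add: d_def power2_eq_square power3_eq_cube)
        ultimately show ?thesis by simp
      qed
      ultimately show ?thesis by (simp add: power_mult_distrib)
    qed
    then have "100 * \<alpha> ^ 3 * (real (card G))\<^sup>2
        \<le> (real s) ^ 3 / (2 * (real n)\<^sup>2) * (real (card G))\<^sup>2"
      by (rule mult_right_mono) simp
    ultimately show ?thesis
      using X(1) up low many \<alpha>_def unfolding r_def[symmetric]
      by (intro exI[of _ X] exI[of _ \<alpha>] conjI) (assumption | linarith)+
  qed
  then show ?thesis
    by (intro exI[of _ "1 / 800"] exI[of _ 3] exI[of _ 8000]) auto
qed

end
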